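(* Let $F$ be a linearly differentially closed differential field of characteristic zero whose field of constants $C$ is algebraically closed and satisfies $C\neq F$. Then $$F(\partial)=F\langle \partial \rangle +F\langle \partial^{-1} \rangle ,$$ i.e. every element of $F(\partial)$ is the sum of an element of $F\langle\partial\rangle$ and an element of $F\langle\partial^{-1}\rangle$.
   Context: A differential field is a (commutative) field $F$ with a derivation $a\mapsto a'$; its field of constants is $C=\{a\in F: a'=0\}$. The ring of differential operators $F\langle\partial\rangle$ is the ring generated by $F$ and a symbol $\partial$ subject to $\partial a-a\partial=a'$ for all $a\in F$. Every nonzero $P\in F\langle\partial\rangle$ is uniquely $P=a_0+a_1\partial+\cdots+a_n\partial^n$ with $a_i\in F$, $a_n\ne 0$; $n=\deg(P)$ is its degree. $P$ acts on $F$ by $P(a)=a_0a+a_1a'+\cdots+a_na^{(n)}$. The ring $F\langle\partial\rangle$ is an Ore domain, and $F(\partial)$ denotes its (noncommutative) field of quotients (the field of rational pseudo-differential operators), whose elements are of the form $P^{-1}Q$ with $P,Q\in F\langle\partial\rangle$, $P\neq 0$. $F\langle\partial^{-1}\rangle$ denotes the subring of $F(\partial)$ generated by $F$ and $\partial^{-1}$. $F$ is called linearly differentially closed if for every $P\in F\langle\partial\rangle$ with $\deg(P)\ge 1$ there is a nonzero $a\in F$ with $P(a)=0$. *)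

theory Defs
  imports
    "HOL-Computational_Algebra.Polynomial"
    "HOL-Library.Set_Algebras"
begin

section \<open>Differential fields\<close>

class differential_field = field +
  fixes der :: "'a \<Rightarrow> 'a"
  assumes der_add: "der (a + b) = der a + der b"
    and der_mult: "der (a * b) = der a * b + a * der b"

lemma der_0 [simp]: "der (0 :: 'a :: differential_field) = 0"
  using der_add[of "0 :: 'a" 0] by (metis add_0 add_left_cancel add_0_right)

lemma der_1 [simp]: "der (1 :: 'a :: differential_field) = 0"
  using der_mult[of "1 :: 'a" 1] by (metis add_left_cancel add_0_right mult_1 mult_1_right)

definition constants :: "'a :: differential_field set" where
  "constants = {a. der a = 0}"

lemma constants_0: "0 \<in> constants"
  and constants_1: "1 \<in> constants"
  and constants_add: "a \<in> constants \<Longrightarrow> b \<in> constants \<Longrightarrow> a + b \<in> constants"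
  and constants_mult: "a \<in> constants \<Longrightarrow> b \<in> constants \<Longrightarrow> a * b \<in> constants"
  by (simp_all add: constants_def der_add der_mult)

lemma constants_uminus: "a \<in> constants \<Longrightarrow> - a \<in> constants"
  using der_add[of a "- a"] by (simp add: constants_def)

lemma constants_inverse: "a \<in> constants \<Longrightarrow> inverse a \<in> constants"
  using der_mult[of a "inverse a"] by (cases "a = 0") (auto simp: constants_def)

text \<open>
  \<open>C\<close> is meant to be a subfield of the ambient field; for the constants this is shown above.
\<close>

definition algebraically_closed_subfield :: "'a :: field set \<Rightarrow> bool" where
  "algebraically_closed_subfield C \<longleftrightarrow>
     (\<forall>p. (\<forall>i. coeff p i \<in> C) \<longrightarrow> degree p > 0 \<longrightarrow> (\<exists>x\<in>C. poly p x = 0))"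


section \<open>Differential operators\<close>

text \<open>
  The polynomial with coefficients \<open>a\<^sub>0, \<dots>, a\<^sub>n\<close> represents the operator
  \<open>a\<^sub>0 + a\<^sub>1 \<partial> + \<dots> + a\<^sub>n \<partial>\<^sup>n\<close>, coefficients on the left. The type is separate from
  \<^typ>\<open>'a poly\<close> because the multiplication is different.
\<close>

typedef (overloaded) 'a diff_op = "UNIV :: 'a :: zero poly set"
  morphisms op_poly of_op_poly ..

setup_lifting type_definition_diff_op

text \<open>
  Left multiplication by \<open>\<partial>\<close>: the relation \<open>\<partial> b = b \<partial> + b'\<close> yields
  \<open>\<partial> (\<Sum>j. b\<^sub>j \<partial>\<^sup>j) = (\<Sum>j. b\<^sub>j \<partial>\<^sup>j\<^sup>+\<^sup>1) + (\<Sum>j. b\<^sub>j' \<partial>\<^sup>j)\<close>.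
\<close>

definition del_left :: "'a :: differential_field poly \<Rightarrow> 'a poly" where
  "del_left Q = pCons 0 Q + map_poly der Q"

definition skew_mult :: "'a :: differential_field poly \<Rightarrow> 'a poly \<Rightarrow> 'a poly" where
  "skew_mult P Q = (\<Sum>i\<le>degree P. smult (coeff P i) ((del_left ^^ i) Q))"

lemma coeff_del_left:
  "coeff (del_left Q) n = (case n of 0 \<Rightarrow> 0 | Suc m \<Rightarrow> coeff Q m) + der (coeff Q n)"
  by (simp add: del_left_def coeff_pCons coeff_map_poly)

lemma del_left_0 [simp]: "del_left 0 = 0"
  by (simp add: del_left_def)

lemma del_left_add: "del_left (P + Q) = del_left P + del_left Q"
  by (rule poly_eqI) (simp add: coeff_del_left der_add split: nat.split)

lemma del_left_smult: "del_left (smult a Q) = smult a (del_left Q) + smult (der a) Q"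
  by (rule poly_eqI) (simp add: coeff_del_left der_mult algebra_simps split: nat.split)

lemma del_left_sum: "del_left (sum f A) = (\<Sum>i\<in>A. del_left (f i))"
  by (induction A rule: infinite_finite_induct) (simp_all add: del_left_add)

lemma del_left_pow_0 [simp]: "(del_left ^^ n) 0 = 0"
  by (induction n) simp_all

lemma del_left_pow_add: "(del_left ^^ n) (P + Q) = (del_left ^^ n) P + (del_left ^^ n) Q"
  by (induction n) (simp_all add: del_left_add)

lemma degree_map_poly_der_le: "degree (map_poly der P) \<le> degree P"
  by (rule degree_le) (simp add: coeff_map_poly coeff_eq_0)

lemma skew_mult_ge:
  assumes "degree P \<le> n"
  shows "skew_mult P Q = (\<Sum>i\<le>n. smult (coeff P i) ((del_left ^^ i) Q))"
  unfolding skew_mult_def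
  by (rule sum.mono_neutral_left) (use assms in \<open>auto simp: coeff_eq_0\<close>)

lemma skew_mult_0_left [simp]: "skew_mult 0 Q = 0"
  and skew_mult_0_right [simp]: "skew_mult P 0 = 0"
  by (simp_all add: skew_mult_def)

lemma skew_mult_add_left: "skew_mult (P + P') Q = skew_mult P Q + skew_mult P' Q"
proof -
  define n where "n = max (degree P) (degree P')"
  have "degree (P + P') \<le> n" "degree P \<le> n" "degree P' \<le> n"
    by (auto simp: n_def degree_add_le_max)
  then show ?thesis
    by (simp add: skew_mult_ge smult_add_left sum.distrib)
qed

lemma skew_mult_add_right: "skew_mult P (Q + Q') = skew_mult P Q + skew_mult P Q'"
  by (simp add: skew_mult_def del_left_pow_add smult_add_right sum.distrib)

lemma smult_sum_right: "smult a (sum f A) = (\<Sum>i\<in>A. smult a (f i))"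
  by (induction A rule: infinite_finite_induct) (simp_all add: smult_add_right)

lemma skew_mult_smult_left: "skew_mult (smult a P) Q = smult a (skew_mult P Q)"
proof -
  have "smult a (skew_mult P Q) = (\<Sum>i\<le>degree P. smult a (smult (coeff P i) ((del_left ^^ i) Q)))"
    unfolding skew_mult_def by (rule smult_sum_right)
  also have "\<dots> = skew_mult (smult a P) Q"
    by (subst skew_mult_ge[of "smult a P" "degree P"]) (simp_all add: degree_smult_le)
  finally show ?thesis ..
qed

lemma skew_mult_sum_left: "skew_mult (sum f A) Q = (\<Sum>i\<in>A. skew_mult (f i) Q)"
  by (induction A rule: infinite_finite_induct) (simp_all add: skew_mult_add_left)

lemma skew_mult_const [simp]: "skew_mult [:a:] Q = smult a Q"
  by (simp add: skew_mult_def)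

lemma skew_mult_pCons_0: "skew_mult (pCons 0 P) Q = (\<Sum>i\<le>degree P. smult (coeff P i) ((del_left ^^ Suc i) Q))"
proof -
  have "skew_mult (pCons 0 P) Q =
      (\<Sum>i\<le>Suc (degree P). smult (coeff (pCons 0 P) i) ((del_left ^^ i) Q))"
    by (rule skew_mult_ge) (simp add: degree_pCons_le)
  also have "\<dots> = (\<Sum>i\<le>degree P. smult (coeff P i) ((del_left ^^ Suc i) Q))"
    by (subst sum.atMost_Suc_shift) simp
  finally show ?thesis .
qed

lemma skew_mult_del [simp]: "skew_mult [:0, 1:] Q = del_left Q"
  using skew_mult_pCons_0[of "[:1:]" Q] by simp

lemma del_left_skew_mult: "del_left (skew_mult P Q) = skew_mult (del_left P) Q"
proof -
  have "del_left (skew_mult P Q) =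
      (\<Sum>i\<le>degree P. smult (coeff P i) ((del_left ^^ Suc i) Q))
      + (\<Sum>i\<le>degree P. smult (der (coeff P i)) ((del_left ^^ i) Q))"
    unfolding skew_mult_def by (simp add: del_left_sum del_left_smult sum.distrib)
  also have "(\<Sum>i\<le>degree P. smult (der (coeff P i)) ((del_left ^^ i) Q)) = skew_mult (map_poly der P) Q"
    by (subst skew_mult_ge[of "map_poly der P" "degree P"])
       (simp_all add: coeff_map_poly degree_map_poly_der_le)
  finally show ?thesis
    by (simp add: del_left_def[of P] skew_mult_add_left skew_mult_pCons_0)
qed

lemma del_left_pow_skew_mult: "(del_left ^^ n) (skew_mult P Q) = skew_mult ((del_left ^^ n) P) Q"
  by (induction n) (simp_all add: del_left_skew_mult)

lemma skew_mult_assoc: "skew_mult (skew_mult P Q) R = skew_mult P (skew_mult Q R)"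
  by (simp add: skew_mult_def[of P] skew_mult_sum_left skew_mult_smult_left del_left_pow_skew_mult)

lemma del_left_pow_1: "(del_left ^^ n) 1 = monom 1 n"
proof (induction n)
  case (Suc n)
  have "del_left (monom (1 :: 'a) n) = monom 1 (Suc n)"
    by (rule poly_eqI) (auto simp: coeff_del_left coeff_monom split: nat.split)
  with Suc show ?case by simp
qed simp

lemma skew_mult_1_right: "skew_mult P 1 = P"
  by (simp add: skew_mult_def del_left_pow_1 smult_monom poly_as_sum_of_monoms)

lemma degree_del_left_le: "degree (del_left Q) \<le> Suc (degree Q)"
  by (rule degree_le) (auto simp: coeff_del_left coeff_eq_0 split: nat.split)

lemma degree_del_left_pow_le: "degree ((del_left ^^ n) Q) \<le> n + degree Q"
proof (induction n)
  case (Suc n)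
  then show ?case using degree_del_left_le[of "(del_left ^^ n) Q"] by simp
qed simp

lemma coeff_del_left_pow: "coeff ((del_left ^^ n) Q) (n + degree Q) = lead_coeff Q"
proof (induction n)
  case (Suc n)
  have "coeff ((del_left ^^ n) Q) (Suc (n + degree Q)) = 0"
    using degree_del_left_pow_le[of n Q] by (intro coeff_eq_0) simp
  with Suc show ?case by (simp add: coeff_del_left)
qed simp

lemma coeff_skew_mult_degree_sum:
  "coeff (skew_mult P Q) (degree P + degree Q) = lead_coeff P * lead_coeff Q"
proof -
  have "coeff ((del_left ^^ i) Q) (degree P + degree Q) = 0" if "i < degree P" for i
    using degree_del_left_pow_le[of i Q] that by (intro coeff_eq_0) simp
  then have "(\<Sum>i\<le>degree P. coeff P i * coeff ((del_left ^^ i) Q) (degree P + degree Q))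
      = (\<Sum>i\<in>{degree P}. coeff P i * coeff ((del_left ^^ i) Q) (degree P + degree Q))"
    by (intro sum.mono_neutral_right) auto
  then show ?thesis
    by (simp add: skew_mult_def coeff_sum coeff_del_left_pow)
qed

lemma skew_mult_eq_0_iff: "skew_mult P Q = 0 \<longleftrightarrow> P = 0 \<or> Q = 0"
  using coeff_skew_mult_degree_sum[of P Q] by auto

instantiation diff_op :: (differential_field) ring_1_no_zero_divisors
begin

lift_definition zero_diff_op :: "'a diff_op" is 0 .
lift_definition one_diff_op :: "'a diff_op" is 1 .
lift_definition plus_diff_op :: "'a diff_op \<Rightarrow> 'a diff_op \<Rightarrow> 'a diff_op" is "(+)" .
lift_definition minus_diff_op :: "'a diff_op \<Rightarrow> 'a diff_op \<Rightarrow> 'a diff_op" is "(-)" .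
lift_definition uminus_diff_op :: "'a diff_op \<Rightarrow> 'a diff_op" is uminus .
lift_definition times_diff_op :: "'a diff_op \<Rightarrow> 'a diff_op \<Rightarrow> 'a diff_op" is skew_mult .

instance
proof
  fix P Q R :: "'a diff_op"
  show "P * Q * R = P * (Q * R)" by transfer (rule skew_mult_assoc)
  show "(P + Q) * R = P * R + Q * R" by transfer (rule skew_mult_add_left)
  show "P * (Q + R) = P * Q + P * R" by transfer (rule skew_mult_add_right)
  show "1 * P = P" by transfer (simp add: one_pCons)
  show "P * 1 = P" by transfer (rule skew_mult_1_right)
  show "(0 :: 'a diff_op) \<noteq> 1" by transfer simp
  show "P \<noteq> 0 \<Longrightarrow> Q \<noteq> 0 \<Longrightarrow> P * Q \<noteq> 0" by transfer (simp add: skew_mult_eq_0_iff)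
qed (transfer; simp)+

end

lift_definition op_coeff :: "'a :: zero diff_op \<Rightarrow> nat \<Rightarrow> 'a" is coeff .
lift_definition op_degree :: "'a :: zero diff_op \<Rightarrow> nat" is degree .
lift_definition op_const :: "'a :: zero \<Rightarrow> 'a diff_op" is "\<lambda>a. [:a:]" .
lift_definition op_del :: "'a :: zero_neq_one diff_op" is "[:0, 1:]" .

definition op_apply :: "'a :: differential_field diff_op \<Rightarrow> 'a \<Rightarrow> 'a" where
  "op_apply P a = (\<Sum>i\<le>op_degree P. op_coeff P i * (der ^^ i) a)"

lemma op_del_commute: "op_del * op_const a - op_const a * op_del = op_const (der a)"
  by transfer (simp add: del_left_def map_poly_pCons)

lemma op_const_add: "op_const (a + b) = op_const a + op_const b"
  and op_const_mult: "op_const (a * b) = op_const a * op_const b"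
  and op_const_1: "op_const 1 = 1"
  by (transfer; simp add: one_pCons)+

lemma op_const_inj: "op_const a = op_const b \<longleftrightarrow> a = b"
  by transfer simp

lemma op_poly_const_mult: "op_poly (op_const a * P) = smult a (op_poly P)"
  by transfer simp

lemma op_poly_del_mult: "op_poly (op_del * P) = del_left (op_poly P)"
  by transfer simp

lemma op_poly_del_pow: "op_poly (op_del ^ n) = monom 1 n"
proof -
  have "op_poly (op_del ^ n) = (del_left ^^ n) (1 :: 'a poly)"
    by (induction n) (simp_all add: op_poly_del_mult one_diff_op.rep_eq)
  then show ?thesis by (simp add: del_left_pow_1)
qed

lemma op_poly_sum: "op_poly (sum f A) = (\<Sum>i\<in>A. op_poly (f i))"
  by (induction A rule: infinite_finite_induct) (simp_all add: zero_diff_op.rep_eq plus_diff_op.rep_eq)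

lemma diff_op_normal_form: "P = (\<Sum>i\<le>op_degree P. op_const (op_coeff P i) * op_del ^ i)"
  by (simp flip: op_poly_inject
      add: op_poly_sum op_poly_const_mult op_poly_del_pow op_degree.rep_eq op_coeff.rep_eq
        smult_monom poly_as_sum_of_monoms)

definition linearly_differentially_closed :: "'a :: differential_field itself \<Rightarrow> bool" where
  "linearly_differentially_closed _ \<longleftrightarrow>
     (\<forall>P :: 'a diff_op. op_degree P \<ge> 1 \<longrightarrow> (\<exists>a. a \<noteq> 0 \<and> op_apply P a = 0))"


section \<open>The skew field of quotients of an Ore domain\<close>

class left_ore_domain = ring_1_no_zero_divisors +
  assumes left_ore: "b \<noteq> 0 \<Longrightarrow> \<exists>u v. u \<noteq> 0 \<and> u * a = v * b"

text \<open>The pair \<open>(p, q)\<close> stands for the left fraction \<open>p\<^sup>-\<^sup>1 q\<close>.\<close>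

definition ore_rel :: "'r :: left_ore_domain \<times> 'r \<Rightarrow> 'r \<times> 'r \<Rightarrow> bool" where
  "ore_rel x y \<longleftrightarrow> fst x \<noteq> 0 \<and> fst y \<noteq> 0 \<and>
     (\<exists>a b. a \<noteq> 0 \<and> b \<noteq> 0 \<and> a * fst x = b * fst y \<and> a * snd x = b * snd y)"

lemma ore_relI:
  assumes "p \<noteq> 0" "p' \<noteq> 0" "a \<noteq> 0" "a * p = b * p'" "a * q = b * q'"
  shows "ore_rel (p, q) (p', q')"
proof -
  have "b \<noteq> 0" using assms by (metis mult_eq_0_iff)
  with assms show ?thesis unfolding ore_rel_def by auto
qed

lemma ore_relD:
  assumes "ore_rel (p, q) (p', q')" "c * p = d * p'"
  shows "c * q = d * q'"
proof (cases "c = 0")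
  case True
  with assms show ?thesis by (auto simp: ore_rel_def)
next
  case False
  obtain a b where ab: "a \<noteq> 0" "a * p = b * p'" "a * q = b * q'" and nz: "p' \<noteq> 0"
    using assms(1) by (auto simp: ore_rel_def)
  obtain u v where uv: "u \<noteq> 0" "u * a = v * c"
    using left_ore[OF False] by blast
  have "v \<noteq> 0" using uv ab by auto
  have "(u * b) * p' = (v * d) * p'"
    by (metis ab(2) assms(2) mult.assoc uv(2))
  then have "u * b = v * d" using nz by simp
  then have "v * (c * q) = v * (d * q')"
    by (metis ab(3) mult.assoc uv(2))
  with \<open>v \<noteq> 0\<close> show ?thesis by simp
qed

lemma ore_rel_refl: "p \<noteq> 0 \<Longrightarrow> ore_rel (p, q) (p, q)"
  by (rule ore_relI[of _ _ 1 1]) auto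

lemma ore_rel_sym: "ore_rel x y \<Longrightarrow> ore_rel y x"
  unfolding ore_rel_def by metis

lemma ore_rel_trans:
  assumes "ore_rel x y" "ore_rel y z"
  shows "ore_rel x z"
proof -
  obtain p q p' q' p'' q'' where xyz: "x = (p, q)" "y = (p', q')" "z = (p'', q'')"
    by (metis surj_pair)
  from assms(1) obtain a b where ab: "a \<noteq> 0" "b \<noteq> 0" "a * p = b * p'" "a * q = b * q'" "p \<noteq> 0"
    unfolding ore_rel_def xyz by auto
  from assms(2) obtain c d where cd: "c \<noteq> 0" "c * p' = d * p''" "c * q' = d * q''" "p'' \<noteq> 0"
    unfolding ore_rel_def xyz by auto
  obtain u v where uv: "u \<noteq> 0" "u * b = v * c" using left_ore[OF cd(1)] by blast
  show ?thesis unfolding xyz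
  proof (rule ore_relI[of _ _ "u * a" "v * d"])
    show "u * a * p = v * d * p''" by (metis ab(3) cd(2) mult.assoc uv(2))
    show "u * a * q = v * d * q''" by (metis ab(4) cd(3) mult.assoc uv(2))
  qed (use ab cd uv in auto)
qed

quotient_type (overloaded) 'r ore_quot = "'r :: left_ore_domain \<times> 'r" / partial: ore_rel
proof (rule part_equivpI)
  show "\<exists>x :: 'r \<times> 'r. ore_rel x x" using ore_rel_refl[of "1 :: 'r"] by auto
  show "symp (ore_rel :: 'r \<times> 'r \<Rightarrow> _)" by (rule sympI) (rule ore_rel_sym)
  show "transp (ore_rel :: 'r \<times> 'r \<Rightarrow> _)" by (rule transpI) (rule ore_rel_trans)
qed

text \<open>
  If \<open>u p = v p'\<close> then \<open>p\<^sup>-\<^sup>1 q + p'\<^sup>-\<^sup>1 q' = (u p)\<^sup>-\<^sup>1 (u q + v q')\<close>;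
  if \<open>u q = v p'\<close> then \<open>p\<^sup>-\<^sup>1 q p'\<^sup>-\<^sup>1 q' = (u p)\<^sup>-\<^sup>1 (v q')\<close>.
  In both cases the result does not depend on the choice of \<open>u \<noteq> 0\<close> and \<open>v\<close>.
\<close>

definition ore_cofactors :: "'r :: left_ore_domain \<Rightarrow> 'r \<Rightarrow> 'r \<times> 'r" where
  "ore_cofactors a b = (SOME (u, v). u \<noteq> 0 \<and> u * a = v * b)"

lemma ore_cofactors:
  assumes "b \<noteq> 0" "ore_cofactors a b = (u, v)"
  shows "u \<noteq> 0 \<and> u * a = v * b"
proof -
  have "\<exists>w. case w of (u, v) \<Rightarrow> u \<noteq> 0 \<and> u * a = v * b"
    using left_ore[OF assms(1), of a] by auto
  from someI_ex[OF this] assms(2) show ?thesis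
    unfolding ore_cofactors_def by simp
qed

definition ore_add :: "'r :: left_ore_domain \<times> 'r \<Rightarrow> 'r \<times> 'r \<Rightarrow> 'r \<times> 'r" where
  "ore_add = (\<lambda>(p, q) (p', q'). let (u, v) = ore_cofactors p p' in (u * p, u * q + v * q'))"

definition ore_mult :: "'r :: left_ore_domain \<times> 'r \<Rightarrow> 'r \<times> 'r \<Rightarrow> 'r \<times> 'r" where
  "ore_mult = (\<lambda>(p, q) (p', q'). let (u, v) = ore_cofactors q p' in (u * p, v * q'))"

definition ore_inverse :: "'r :: left_ore_domain \<times> 'r \<Rightarrow> 'r \<times> 'r" where
  "ore_inverse = (\<lambda>(p, q). if q = 0 then (1, 0) else (q, p))"

lemma ore_add_rel:
  assumes r: "ore_rel (p1, q1) (p1', q1')" and s: "ore_rel (p2, q2) (p2', q2')"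
    and c: "u \<noteq> 0" "u * p1 = v * p2" and c': "u' \<noteq> 0" "u' * p1' = v' * p2'"
  shows "ore_rel (u * p1, u * q1 + v * q2) (u' * p1', u' * q1' + v' * q2')"
proof -
  have nz: "p1 \<noteq> 0" "p1' \<noteq> 0" using r by (auto simp: ore_rel_def)
  obtain c d where cd: "c \<noteq> 0" "c * (u * p1) = d * (u' * p1')"
    using left_ore[of "u' * p1'" "u * p1"] nz c'(1) by auto
  have "(c * u) * q1 = (d * u') * q1'"
    using cd by (intro ore_relD[OF r]) (simp add: mult.assoc)
  moreover have "(c * v) * q2 = (d * v') * q2'"
    using cd c c' by (intro ore_relD[OF s]) (simp add: mult.assoc)
  ultimately show ?thesis
    using nz c(1) c'(1) cd by (intro ore_relI[of _ _ c d]) (simp_all add: distrib_left mult.assoc)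
qed

lemma ore_mult_rel:
  assumes r: "ore_rel (p1, q1) (p1', q1')" and s: "ore_rel (p2, q2) (p2', q2')"
    and c: "u \<noteq> 0" "u * q1 = v * p2" and c': "u' \<noteq> 0" "u' * q1' = v' * p2'"
  shows "ore_rel (u * p1, v * q2) (u' * p1', v' * q2')"
proof -
  have nz: "p1 \<noteq> 0" "p1' \<noteq> 0" using r by (auto simp: ore_rel_def)
  obtain c d where cd: "c \<noteq> 0" "c * (u * p1) = d * (u' * p1')"
    using left_ore[of "u' * p1'" "u * p1"] nz c'(1) by auto
  have "(c * u) * q1 = (d * u') * q1'"
    using cd by (intro ore_relD[OF r]) (simp add: mult.assoc)
  then have "(c * v) * q2 = (d * v') * q2'"
    using c c' by (intro ore_relD[OF s]) (metis mult.assoc)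
  then show ?thesis
    using nz c(1) c'(1) cd by (intro ore_relI[of _ _ c d]) (simp_all add: mult.assoc)
qed

instantiation ore_quot :: (left_ore_domain) division_ring
begin

lift_definition zero_ore_quot :: "'a ore_quot" is "(1, 0)"
  by (rule ore_rel_refl) simp

lift_definition one_ore_quot :: "'a ore_quot" is "(1, 1)"
  by (rule ore_rel_refl) simp

lift_definition plus_ore_quot :: "'a ore_quot \<Rightarrow> 'a ore_quot \<Rightarrow> 'a ore_quot" is ore_add
proof (clarify, goal_cases)
  case (1 p1 q1 p1' q1' p2 q2 p2' q2')
  obtain u v u' v' where uv: "ore_cofactors p1 p2 = (u, v)" "ore_cofactors p1' p2' = (u', v')"
    by (metis surj_pair)
  have "p2 \<noteq> 0" "p2' \<noteq> 0" using 1 by (auto simp: ore_rel_def)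
  then have "u \<noteq> 0 \<and> u * p1 = v * p2" "u' \<noteq> 0 \<and> u' * p1' = v' * p2'"
    using ore_cofactors uv by blast+
  then have "ore_rel (u * p1, u * q1 + v * q2) (u' * p1', u' * q1' + v' * q2')"
    by (intro ore_add_rel[OF 1]) blast+
  then show ?case
    by (simp only: ore_add_def uv Let_def prod.case)
qed

lift_definition times_ore_quot :: "'a ore_quot \<Rightarrow> 'a ore_quot \<Rightarrow> 'a ore_quot" is ore_mult
proof (clarify, goal_cases)
  case (1 p1 q1 p1' q1' p2 q2 p2' q2')
  obtain u v u' v' where uv: "ore_cofactors q1 p2 = (u, v)" "ore_cofactors q1' p2' = (u', v')"
    by (metis surj_pair)
  have "p2 \<noteq> 0" "p2' \<noteq> 0" using 1 by (auto simp: ore_rel_def)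
  then have "u \<noteq> 0 \<and> u * q1 = v * p2" "u' \<noteq> 0 \<and> u' * q1' = v' * p2'"
    using ore_cofactors uv by blast+
  then have "ore_rel (u * p1, v * q2) (u' * p1', v' * q2')"
    by (intro ore_mult_rel[OF 1]) blast+
  then show ?case
    by (simp only: ore_mult_def uv Let_def prod.case)
qed

lift_definition uminus_ore_quot :: "'a ore_quot \<Rightarrow> 'a ore_quot" is "\<lambda>(p, q). (p, - q)"
  by (fastforce simp: ore_rel_def)

lift_definition inverse_ore_quot :: "'a ore_quot \<Rightarrow> 'a ore_quot" is ore_inverse
  by (fastforce simp: ore_rel_def ore_inverse_def)

definition minus_ore_quot :: "'a ore_quot \<Rightarrow> 'a ore_quot \<Rightarrow> 'a ore_quot" where
  "minus_ore_quot x y = x + - y"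

definition divide_ore_quot :: "'a ore_quot \<Rightarrow> 'a ore_quot \<Rightarrow> 'a ore_quot" where
  "divide_ore_quot x y = x * inverse y"

lift_definition lfrac :: "'a \<Rightarrow> 'a \<Rightarrow> 'a ore_quot" is "\<lambda>p q. if p = 0 then (1, 0) else (p, q)"
  by (auto intro: ore_rel_refl)

lemma lfrac_eqI:
  assumes "p \<noteq> 0" "a \<noteq> 0"
  shows "lfrac (a * p) (a * q) = lfrac p q"
  using assms
proof (transfer, goal_cases)
  case (1 p a q)
  then show ?case by (auto intro!: ore_relI[of _ _ 1 a])
qed

lemma lfrac_cases: obtains p q where "p \<noteq> 0" "x = lfrac p q"
proof -
  have "\<exists>p q. p \<noteq> 0 \<and> x = lfrac p q"
  proof (transfer, goal_cases)
    case (1 x)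
    then show ?case
      by (cases x) (auto simp: ore_rel_def)
  qed
  then show ?thesis using that by blast
qed

lemma lfrac_add:
  assumes "p \<noteq> 0"
  shows "lfrac p q + lfrac p q' = lfrac p (q + q')"
  using assms
proof (transfer, goal_cases)
  case (1 p q q')
  obtain u v where uv: "ore_cofactors p p = (u, v)" by (metis surj_pair)
  with ore_cofactors[of p p u v] 1 have "u \<noteq> 0" "u = v" by auto
  with uv 1 show ?case
    by (auto simp: ore_add_def distrib_left intro!: ore_relI[of _ _ 1 u])
qed

lemma lfrac_mult:
  assumes "p \<noteq> 0" "a \<noteq> 0"
  shows "lfrac p (m * a) * lfrac a b = lfrac p (m * b)"
  using assms
proof (transfer, goal_cases)
  case (1 p a m b)
  obtain u v where uv: "ore_cofactors (m * a) a = (u, v)" by (metis surj_pair)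
  with ore_cofactors[of a "m * a" u v] 1 have "u \<noteq> 0" "(u * m) * a = v * a"
    by (auto simp: mult.assoc)
  with 1 have "u \<noteq> 0" "v = u * m" by simp_all
  with uv 1 show ?case
    by (auto simp: ore_mult_def mult.assoc intro!: ore_relI[of _ _ 1 u])
qed

lemma lfrac_uminus: "- lfrac p q = lfrac p (- q)"
  by transfer (auto intro!: ore_rel_refl)

lemma zero_lfrac: "p \<noteq> 0 \<Longrightarrow> 0 = lfrac p 0"
proof (transfer, goal_cases)
  case (1 p)
  then show ?case by (auto intro!: ore_relI[of _ _ p 1])
qed

lemma one_lfrac: "p \<noteq> 0 \<Longrightarrow> 1 = lfrac p p"
proof (transfer, goal_cases)
  case (1 p)
  then show ?case by (auto intro!: ore_relI[of _ _ p 1])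
qed

lemma lfrac_eq_0_iff: "p \<noteq> 0 \<Longrightarrow> lfrac p q = 0 \<longleftrightarrow> q = 0"
  by transfer (auto simp: ore_rel_def)

lemma inverse_lfrac: "p \<noteq> 0 \<Longrightarrow> q \<noteq> 0 \<Longrightarrow> inverse (lfrac p q) = lfrac q p"
  by transfer (auto simp: ore_inverse_def intro!: ore_rel_refl)

lemma lfrac_cases_mult:
  assumes "a \<noteq> 0"
  obtains p m where "p \<noteq> 0" "x = lfrac p (m * a)"
proof -
  obtain p q where x: "p \<noteq> 0" "x = lfrac p q" by (rule lfrac_cases)
  obtain u v where "u \<noteq> 0" "u * q = v * a" using left_ore[OF assms] by blast
  with x show ?thesis using that[of "u * p" v] lfrac_eqI[of p u q] by auto
qed

lemma lfrac_cases2: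
  obtains p q r where "p \<noteq> 0" "x = lfrac p q" "y = lfrac p r"
proof -
  obtain p r where y: "p \<noteq> 0" "y = lfrac p r" by (rule lfrac_cases)
  obtain s q where x: "s \<noteq> 0" "x = lfrac s q" by (rule lfrac_cases)
  obtain u v where uv: "u \<noteq> 0" "u * s = v * p" using left_ore[OF y(1)] by blast
  with x y have "v \<noteq> 0" by auto
  show ?thesis
    using that[of "u * s" "u * q" "v * r"] x y uv \<open>v \<noteq> 0\<close> lfrac_eqI[of s u q] lfrac_eqI[of p v r]
    by auto
qed

lemma lfrac_cases3:
  obtains p q r s where "p \<noteq> 0" "x = lfrac p q" "y = lfrac p r" "z = lfrac p s"
proof -
  obtain a q r where xy: "a \<noteq> 0" "x = lfrac a q" "y = lfrac a r" by (rule lfrac_cases2)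
  obtain b s where z: "b \<noteq> 0" "z = lfrac b s" by (rule lfrac_cases)
  obtain u v where uv: "u \<noteq> 0" "u * a = v * b" using left_ore[OF z(1)] by blast
  with xy z have "v \<noteq> 0" by auto
  show ?thesis
    using that[of "u * a" "u * q" "u * r" "v * s"] xy z uv \<open>v \<noteq> 0\<close>
      lfrac_eqI[of a u q] lfrac_eqI[of a u r] lfrac_eqI[of b v s]
    by auto
qed

lemma lfrac_cases2_mult:
  assumes "a \<noteq> 0"
  obtains p m n where "p \<noteq> 0" "x = lfrac p (m * a)" "y = lfrac p (n * a)"
proof -
  obtain p q r where xy: "p \<noteq> 0" "x = lfrac p q" "y = lfrac p r" by (rule lfrac_cases2)
  obtain u v where uv: "u \<noteq> 0" "u * q = v * a" using left_ore[OF assms] by blast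
  obtain w z where wz: "w \<noteq> 0" "w * (u * r) = z * a" using left_ore[OF assms] by blast
  have "(w * u) * q = (w * v) * a" "(w * u) * r = z * a"
    using uv wz by (simp_all add: mult.assoc)
  then show ?thesis
    using that[of "w * u * p" "w * v" z] xy uv wz
      lfrac_eqI[of p "w * u" q] lfrac_eqI[of p "w * u" r]
    by auto
qed

instance
proof
  fix x y z :: "'a ore_quot"
  show "x + y + z = x + (y + z)"
    by (rule lfrac_cases3[of x y z]) (simp add: lfrac_add add.assoc)
  show "x + y = y + x"
    by (rule lfrac_cases2[of x y]) (simp add: lfrac_add add.commute)
  show "0 + x = x"
    by (rule lfrac_cases[of x]) (simp add: zero_lfrac lfrac_add)
  show "- x + x = 0"
    by (rule lfrac_cases[of x]) (simp add: lfrac_uminus zero_lfrac lfrac_add)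
  show "x - y = x + - y" by (rule minus_ore_quot_def)
  show "x * y * z = x * (y * z)"
  proof -
    obtain r s where z: "r \<noteq> 0" "z = lfrac r s" by (rule lfrac_cases)
    obtain q n where y: "q \<noteq> 0" "y = lfrac q (n * r)" by (rule lfrac_cases_mult[OF z(1)])
    obtain p m where x: "p \<noteq> 0" "x = lfrac p (m * q)" by (rule lfrac_cases_mult[OF y(1)])
    show ?thesis
      using x y z lfrac_mult[of p r "m * n" s] by (simp add: lfrac_mult mult.assoc)
  qed
  show "1 * x = x"
  proof -
    obtain p q where x: "p \<noteq> 0" "x = lfrac p q" by (rule lfrac_cases)
    then show ?thesis using lfrac_mult[of p p 1 q] one_lfrac[of p] by simp
  qed
  show "x * 1 = x"
  proof -
    obtain p q where x: "p \<noteq> 0" "x = lfrac p q" by (rule lfrac_cases)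
    then show ?thesis using lfrac_mult[of p 1 q 1] one_lfrac[of "1 :: 'a"] by simp
  qed
  show "(x + y) * z = x * z + y * z"
  proof -
    obtain a b where z: "a \<noteq> 0" "z = lfrac a b" by (rule lfrac_cases)
    obtain p m n where xy: "p \<noteq> 0" "x = lfrac p (m * a)" "y = lfrac p (n * a)"
      by (rule lfrac_cases2_mult[OF z(1)])
    then show ?thesis
      using z lfrac_mult[of p a "m + n" b] by (simp add: lfrac_add lfrac_mult distrib_right)
  qed
  show "x * (y + z) = x * y + x * z"
  proof -
    obtain a b c where yz: "a \<noteq> 0" "y = lfrac a b" "z = lfrac a c" by (rule lfrac_cases2)
    obtain p m where x: "p \<noteq> 0" "x = lfrac p (m * a)" by (rule lfrac_cases_mult[OF yz(1)])
    then show ?thesis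
      using yz by (simp add: lfrac_add lfrac_mult distrib_left)
  qed
  show "(0 :: 'a ore_quot) \<noteq> 1"
    by transfer (auto simp: ore_rel_def)
  show "inverse (0 :: 'a ore_quot) = 0"
    by transfer (auto simp: ore_inverse_def intro!: ore_rel_refl)
  show "x div y = x * inverse y" by (rule divide_ore_quot_def)
  show "inverse x * x = 1" "x * inverse x = 1" if "x \<noteq> 0"
  proof -
    obtain p q where x: "p \<noteq> 0" "x = lfrac p q" by (rule lfrac_cases)
    with that have "q \<noteq> 0" by (simp add: lfrac_eq_0_iff)
    then show "inverse x * x = 1" "x * inverse x = 1"
      using x lfrac_mult[of q p 1 q] lfrac_mult[of p q 1 p]
      by (simp_all add: inverse_lfrac flip: one_lfrac)
  qed
qed

end

definition of_domain :: "'r :: left_ore_domain \<Rightarrow> 'r ore_quot" where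
  "of_domain r = lfrac 1 r"

lemma of_domain_add: "of_domain (a + b) = of_domain a + of_domain b"
  by (simp add: of_domain_def lfrac_add)

lemma of_domain_mult: "of_domain (a * b) = of_domain a * of_domain b"
  using lfrac_mult[of 1 1 a b] by (simp add: of_domain_def)

lemma of_domain_1: "of_domain 1 = 1"
  by (simp add: of_domain_def flip: one_lfrac)

lemma of_domain_inj: "of_domain a = of_domain b \<longleftrightarrow> a = b"
  unfolding of_domain_def by transfer (auto simp: ore_rel_def intro!: exI[of _ 1])

lemma lfrac_eq_inverse_mult:
  assumes "p \<noteq> 0"
  shows "lfrac p q = inverse (of_domain p) * of_domain q"
  using assms lfrac_mult[of p 1 1 q] by (simp add: of_domain_def inverse_lfrac)

lemma ore_quot_fraction: "\<exists>p q. p \<noteq> 0 \<and> x = inverse (of_domain p) * of_domain q"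
  by (metis lfrac_cases lfrac_eq_inverse_mult)


section \<open>Rational pseudo-differential operators\<close>

lemma op_degree_mult_less:
  fixes P Q :: "'a :: differential_field diff_op"
  assumes "Q \<noteq> 0" "op_degree Q \<le> op_degree P" "op_degree P > 0"
  shows "\<exists>S. op_degree (P - S * Q) < op_degree P"
  using assms
proof (transfer, goal_cases)
  case (1 Q P)
  define n where "n = degree P - degree Q"
  define S where "S = monom (lead_coeff P / lead_coeff Q) n"
  have nz: "lead_coeff P / lead_coeff Q \<noteq> 0" using 1 by auto
  have deg: "degree S + degree Q = degree P"
    using 1 nz by (simp add: S_def n_def degree_monom_eq)
  have "lead_coeff S = lead_coeff P / lead_coeff Q"
    using nz by (simp add: S_def degree_monom_eq)
  then have lc: "coeff (skew_mult S Q) (degree P) = lead_coeff P"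
    using coeff_skew_mult_degree_sum[of S Q] deg 1 by simp
  have "degree (skew_mult S Q) \<le> degree P"
    unfolding skew_mult_def
  proof (rule degree_sum_le)
    fix i assume "i \<in> {..degree S}"
    then show "degree (smult (coeff S i) ((del_left ^^ i) Q)) \<le> degree P"
      using degree_del_left_pow_le[of i Q] deg
      by (intro order.trans[OF degree_smult_le]) simp
  qed simp
  then have "degree (P - skew_mult S Q) \<le> degree P" by (intro degree_diff_le) simp_all
  moreover have "degree (P - skew_mult S Q) \<noteq> degree P"
    using lc 1 by (metis coeff_diff diff_self leading_coeff_0_iff degree_0 less_irrefl)
  ultimately show ?case by (intro exI[of _ S]) simp
qed

lemma op_degree_0: "op_degree P = 0 \<Longrightarrow> \<exists>a. P = op_const a"
  by transfer (metis degree_eq_zeroE)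

lemma diff_op_right_division:
  fixes P Q :: "'a :: differential_field diff_op"
  assumes "Q \<noteq> 0"
  shows "\<exists>S R. P = S * Q + R \<and> (R = 0 \<or> op_degree R < op_degree Q)"
proof (induction "op_degree P" arbitrary: P rule: less_induct)
  case less
  consider "op_degree P < op_degree Q" | "op_degree P = 0" "op_degree Q = 0"
    | "op_degree Q \<le> op_degree P" "op_degree P > 0" by linarith
  then show ?case
  proof cases
    case 1
    then show ?thesis by (intro exI[of _ 0] exI[of _ P]) simp
  next
    case 2
    then obtain a b where ab: "P = op_const a" "Q = op_const b" by (metis op_degree_0)
    with assms have "b \<noteq> 0" by (metis op_const.abs_eq zero_diff_op_def pCons_0_0)
    then have "P = op_const (a / b) * Q" by (simp add: ab flip: op_const_mult)
    then show ?thesis by (intro exI[of _ "op_const (a / b)"] exI[of _ 0]) simp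
  next
    case 3
    obtain S where "op_degree (P - S * Q) < op_degree P"
      using op_degree_mult_less[OF assms 3] by blast
    from less[OF this] obtain S' R where
      "P - S * Q = S' * Q + R" "R = 0 \<or> op_degree R < op_degree Q" by blast
    then show ?thesis
      by (intro exI[of _ "S + S'"] exI[of _ R]) (simp add: algebra_simps)
  qed
qed

instance diff_op :: (differential_field) left_ore_domain
proof
  fix P Q :: "'a diff_op"
  assume "Q \<noteq> 0"
  then show "\<exists>U V. U \<noteq> 0 \<and> U * P = V * Q"
  proof (induction "op_degree Q" arbitrary: P Q rule: less_induct)
    case less
    obtain S R where SR: "P = S * Q + R" "R = 0 \<or> op_degree R < op_degree Q"
      using diff_op_right_division[OF less.prems] by blast
    show ?case
    proof (cases "R = 0")
      case True
      with SR show ?thesis by (intro exI[of _ 1] exI[of _ S]) simp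
    next
      case False
      with SR less.hyps[of R Q] obtain U V where UV: "U \<noteq> 0" "U * Q = V * R" by auto
      have "V \<noteq> 0" using UV less.prems by auto
      moreover have "V * P = (V * S + U) * Q"
        using SR UV by (simp add: algebra_simps)
      ultimately show ?thesis by blast
    qed
  qed
qed

type_synonym 'a rat_pseudo_diff_op = "'a diff_op ore_quot"

definition diff_ops :: "'a :: differential_field rat_pseudo_diff_op set" where
  "diff_ops = range of_domain"

inductive_set subring_generated :: "'r :: ring_1 set \<Rightarrow> 'r set" for S where
  generator: "x \<in> S \<Longrightarrow> x \<in> subring_generated S"
| one: "1 \<in> subring_generated S"
| diff: "x \<in> subring_generated S \<Longrightarrow> y \<in> subring_generated S \<Longrightarrow> x - y \<in> subring_generated S"
| mult: "x \<in> subring_generated S \<Longrightarrow> y \<in> subring_generated S \<Longrightarrow> x * y \<in> subring_generated S"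

definition inverse_diff_ops :: "'a :: differential_field rat_pseudo_diff_op set" where
  "inverse_diff_ops =
     subring_generated (insert (inverse (of_domain op_del)) (range (\<lambda>a. of_domain (op_const a))))"

end

theory Submission
  imports Defs
begin

text \<open>
  Every element of \<open>F(\<partial>)\<close> has the form \<open>P\<^sup>-\<^sup>1 Q\<close>, and the two factors are treated separately.

  A nonzero solution \<open>a\<close> of \<open>P(a) = 0\<close> splits off a right factor of degree one: the remainder
  of \<open>P a\<close> modulo right multiples of \<open>\<partial>\<close> is the function \<open>P(a)\<close>
  (\<open>op_mult_const_remainder\<close>), so \<open>P a = T \<partial>\<close> and \<open>P = T \<partial> a\<^sup>-\<^sup>1\<close> with \<open>T\<close> of smaller degree.
  Over a linearly differentially closed field this can be repeated until a function is left.
  Inverting the factorisation writes \<open>P\<^sup>-\<^sup>1\<close> as a product of functions and copies of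
  \<open>\<partial>\<^sup>-\<^sup>1\<close>, so \<open>P\<^sup>-\<^sup>1\<close> lies in \<open>F\<langle>\<partial>\<^sup>-\<^sup>1\<rangle>\<close> (\<open>inverse_diff_op_in_inverse_diff_ops\<close>).

  It remains to multiply an element of \<open>F\<langle>\<partial>\<^sup>-\<^sup>1\<rangle>\<close> by \<open>Q\<close> on the right.
  The relation \<open>\<partial>\<^sup>-\<^sup>1 a \<partial> = a - \<partial>\<^sup>-\<^sup>1 a'\<close> lets each \<open>\<partial>\<close> cancel against a \<open>\<partial>\<^sup>-\<^sup>1\<close> standing to its
  left, and where there is none the result is a multiple \<open>f \<partial>\<close> by a function
  (\<open>inverse_diff_op_mult_del\<close>).
  Hence the product stays in \<open>F\<langle>\<partial>\<rangle> + F\<langle>\<partial>\<^sup>-\<^sup>1\<rangle>\<close> (\<open>inverse_diff_op_mult_diff_op\<close>).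
\<close>

section \<open>Degrees and the embedding into the quotient field\<close>

lemma op_const_0: "op_const 0 = 0"
  by transfer simp

lemma op_const_eq_0_iff: "op_const a = 0 \<longleftrightarrow> a = 0"
  by transfer simp

lemma op_del_nonzero: "(op_del :: 'a :: differential_field diff_op) \<noteq> 0"
  by transfer simp

lemma op_degree_del: "op_degree (op_del :: 'a :: differential_field diff_op) = 1"
  by transfer simp

lemma op_del_mult_const: "op_del * op_const a = op_const a * op_del + op_const (der a)"
  using op_del_commute[of a] by (simp add: algebra_simps)

lemma op_degree_mult_ge:
  assumes "P \<noteq> 0" "Q \<noteq> 0"
  shows "op_degree P + op_degree Q \<le> op_degree (P * Q)"
  using assms
  by transfer (intro le_degree, simp add: coeff_skew_mult_degree_sum)

lemma of_domain_0: "of_domain 0 = 0"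
  by (simp add: of_domain_def lfrac_eq_0_iff)

lemma of_domain_eq_0_iff: "of_domain a = 0 \<longleftrightarrow> a = 0"
  by (metis of_domain_0 of_domain_inj)

lemma of_domain_diff: "of_domain (a - b) = of_domain a - of_domain b"
  using of_domain_add[of "a - b" b] by (simp add: eq_diff_eq)

lemma of_domain_sum: "of_domain (sum f A) = (\<Sum>i\<in>A. of_domain (f i))"
  by (induction A rule: infinite_finite_induct) (simp_all add: of_domain_0 of_domain_add)

section \<open>Splitting off factors of degree one\<close>

lemma op_del_pow_mult_const_remainder:
  "\<exists>T. op_del ^ i * op_const a = T * op_del + op_const ((der ^^ i) a)"
proof (induction i)
  case 0
  show ?case by (intro exI[of _ 0]) simp
next
  case (Suc i)
  then obtain T where "op_del ^ i * op_const a = T * op_del + op_const ((der ^^ i) a)" by blast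
  then have "op_del ^ Suc i * op_const a = op_del * (T * op_del + op_const ((der ^^ i) a))"
    by (simp add: mult.assoc)
  also have "\<dots> = (op_del * T + op_const ((der ^^ i) a)) * op_del + op_const ((der ^^ Suc i) a)"
    by (simp add: distrib_left distrib_right mult.assoc op_del_mult_const)
  finally show ?case by blast
qed

text \<open>
  This is the analogue of the remainder theorem for polynomials: modulo the left ideal generated by
  \<open>\<partial>\<close>, which annihilates \<open>1\<close>, an operator is determined by its value at \<open>1\<close>, and
  \<open>P a\<close> has the value \<open>P(a)\<close> there.
\<close>

lemma op_mult_const_remainder:
  "\<exists>T. P * op_const a = T * op_del + op_const (op_apply P a)"
proof -
  obtain T where T: "\<And>i. op_del ^ i * op_const a = T i * op_del + op_const ((der ^^ i) a)"
    using op_del_pow_mult_const_remainder[of _ a] by metis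
  have sum_const: "op_const (\<Sum>i\<le>n. f i) = (\<Sum>i\<le>n. op_const (f i))" for f :: "nat \<Rightarrow> 'a" and n
    by (induction n) (simp_all add: op_const_add)
  let ?S = "\<Sum>i\<le>op_degree P. op_const (op_coeff P i) * T i"
  have "P * op_const a = (\<Sum>i\<le>op_degree P. op_const (op_coeff P i) * op_del ^ i) * op_const a"
    by (simp flip: diff_op_normal_form)
  also have "\<dots> = (\<Sum>i\<le>op_degree P.
      op_const (op_coeff P i) * (T i * op_del + op_const ((der ^^ i) a)))"
    by (simp add: sum_distrib_right mult.assoc T)
  also have "\<dots> = ?S * op_del + op_const (op_apply P a)"
    unfolding op_apply_def sum_const
    by (simp add: distrib_left sum.distrib sum_distrib_right mult.assoc op_const_mult)
  finally show ?thesis by blast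
qed

lemma op_factor_solution:
  assumes "a \<noteq> 0" "op_apply P a = 0"
  obtains T where "P = T * op_del * op_const (inverse a)"
proof -
  obtain T where "P * op_const a = T * op_del"
    using op_mult_const_remainder[of P a] assms(2) by (auto simp: op_const_0)
  then have "T * op_del * op_const (inverse a) = P * op_const (a * inverse a)"
    by (metis op_const_mult mult.assoc)
  with assms(1) have "P = T * op_del * op_const (inverse a)" by (simp add: op_const_1)
  then show ?thesis by (rule that)
qed

lemma const_in_inverse_diff_ops: "of_domain (op_const a) \<in> inverse_diff_ops"
  and inverse_del_in_inverse_diff_ops: "inverse (of_domain op_del) \<in> inverse_diff_ops"
  by (auto simp: inverse_diff_ops_def intro: subring_generated.generator)

lemma inverse_diff_ops_mult:
  "x \<in> inverse_diff_ops \<Longrightarrow> y \<in> inverse_diff_ops \<Longrightarrow> x * y \<in> inverse_diff_ops"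
  unfolding inverse_diff_ops_def by (rule subring_generated.mult)

lemma inverse_diff_ops_diff:
  "x \<in> inverse_diff_ops \<Longrightarrow> y \<in> inverse_diff_ops \<Longrightarrow> x - y \<in> inverse_diff_ops"
  unfolding inverse_diff_ops_def by (rule subring_generated.diff)

lemma inverse_diff_ops_0: "0 \<in> inverse_diff_ops"
  using const_in_inverse_diff_ops[of 0] by (simp add: op_const_0 of_domain_0)

lemma inverse_diff_ops_add:
  assumes "x \<in> inverse_diff_ops" "y \<in> inverse_diff_ops"
  shows "x + y \<in> inverse_diff_ops"
  using inverse_diff_ops_diff[OF assms(1) inverse_diff_ops_diff[OF inverse_diff_ops_0 assms(2)]]
  by simp

lemma inverse_const:
  assumes "a \<noteq> 0"
  shows "inverse (of_domain (op_const a)) = of_domain (op_const (inverse a))"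
proof (rule inverse_unique)
  show "of_domain (op_const a) * of_domain (op_const (inverse a)) = 1"
    using assms by (simp add: op_const_1 of_domain_1 flip: of_domain_mult op_const_mult)
qed

text \<open>
  A solution \<open>a\<close> gives \<open>P = T \<partial> a\<^sup>-\<^sup>1\<close>, so \<open>P\<^sup>-\<^sup>1 = a \<partial>\<^sup>-\<^sup>1 T\<^sup>-\<^sup>1\<close>, and \<open>T\<close> has smaller degree.
\<close>

lemma inverse_diff_op_in_inverse_diff_ops:
  fixes P :: "'a :: differential_field diff_op"
  assumes closed: "linearly_differentially_closed TYPE('a)"
    and "P \<noteq> 0"
  shows "inverse (of_domain P) \<in> inverse_diff_ops"
  using \<open>P \<noteq> 0\<close>
proof (induction "op_degree P" arbitrary: P rule: less_induct)
  case less
  show ?case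
  proof (cases "op_degree P = 0")
    case True
    then obtain b where b: "P = op_const b" using op_degree_0 by blast
    with less.prems have "b \<noteq> 0" by (simp add: op_const_eq_0_iff)
    then show ?thesis by (simp add: b inverse_const const_in_inverse_diff_ops)
  next
    case False
    then obtain a where a: "a \<noteq> 0" "op_apply P a = 0"
      using closed by (auto simp: linearly_differentially_closed_def Suc_le_eq)
    then obtain T where P: "P = T * op_del * op_const (inverse a)"
      using op_factor_solution by blast
    have nonzero: "T \<noteq> 0" "T * op_del \<noteq> 0" "op_const (inverse a) \<noteq> 0"
      using less.prems by (auto simp: P)
    have "op_degree T < op_degree P"
      using op_degree_mult_ge[OF nonzero(1) op_del_nonzero] op_degree_mult_ge[OF nonzero(2,3)]
      by (simp add: P op_degree_del)
    then have "inverse (of_domain T) \<in> inverse_diff_ops"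
      using less.hyps nonzero(1) by blast
    moreover have "inverse (of_domain P) =
        of_domain (op_const a) * (inverse (of_domain op_del) * inverse (of_domain T))"
      using nonzero a
      by (simp add: P of_domain_mult of_domain_eq_0_iff op_del_nonzero
            nonzero_inverse_mult_distrib inverse_const)
    ultimately show ?thesis
      by (simp add: inverse_diff_ops_mult const_in_inverse_diff_ops inverse_del_in_inverse_diff_ops)
  qed
qed

section \<open>Multiplying by differential operators on the right\<close>

lemma inverse_del_mult_const_mult_del:
  "inverse (of_domain op_del) * of_domain (op_const a) * of_domain op_del =
     of_domain (op_const a) - inverse (of_domain op_del) * of_domain (op_const (der a))"
proof -
  have "op_const a * op_del = op_del * op_const a - op_const (der a)"
    by (simp add: op_del_mult_const)
  then have "of_domain (op_const a) * of_domain op_del =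
      of_domain op_del * of_domain (op_const a) - of_domain (op_const (der a))"
    by (metis of_domain_mult of_domain_diff)
  moreover have "inverse (of_domain op_del) * of_domain op_del = (1 :: 'a rat_pseudo_diff_op)"
    by (simp add: of_domain_eq_0_iff op_del_nonzero)
  ultimately show ?thesis
    by (simp add: mult.assoc right_diff_distrib) (simp flip: mult.assoc)
qed

text \<open>
  The function \<open>a\<close> between \<open>x\<close> and \<open>\<partial>\<close> makes the statement stable under products: if
  \<open>y a \<partial> = f \<partial> + w\<close>, then \<open>x y a \<partial> = x f \<partial> + x w\<close>, and \<open>x f \<partial>\<close> is again of the form that is
  covered.
\<close>

lemma inverse_diff_op_mult_del:
  assumes "x \<in> inverse_diff_ops"
  shows "\<exists>f. \<exists>w\<in>inverse_diff_ops.
    x * of_domain (op_const a) * of_domain op_del = of_domain (op_const f) * of_domain op_del + w"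
  using assms[unfolded inverse_diff_ops_def]
proof (induction arbitrary: a rule: subring_generated.induct)
  case (generator x)
  then consider "x = inverse (of_domain op_del)" | b where "x = of_domain (op_const b)" by blast
  then show ?case
  proof cases
    case 1
    then have "x * of_domain (op_const a) * of_domain op_del = of_domain (op_const 0) * of_domain op_del
        + (of_domain (op_const a) - x * of_domain (op_const (der a)))"
      by (simp add: inverse_del_mult_const_mult_del op_const_0 of_domain_0)
    with 1 show ?thesis
      by (blast intro: inverse_diff_ops_diff inverse_diff_ops_mult const_in_inverse_diff_ops
          inverse_del_in_inverse_diff_ops)
  next
    case 2
    then have "x * of_domain (op_const a) * of_domain op_del =
        of_domain (op_const (b * a)) * of_domain op_del + 0"
      by (simp add: op_const_mult of_domain_mult)
    then show ?thesis using inverse_diff_ops_0 by blast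
  qed
next
  case one
  show ?case by (intro exI[of _ a] bexI[of _ 0]) (simp_all add: inverse_diff_ops_0)
next
  case (diff x y)
  obtain f v g w where vw: "v \<in> inverse_diff_ops" "w \<in> inverse_diff_ops"
    and "x * of_domain (op_const a) * of_domain op_del = of_domain (op_const f) * of_domain op_del + v"
    and "y * of_domain (op_const a) * of_domain op_del = of_domain (op_const g) * of_domain op_del + w"
    using diff.IH by meson
  then have "(x - y) * of_domain (op_const a) * of_domain op_del =
      of_domain (op_const (f - g)) * of_domain op_del + (v - w)"
    using op_const_add[of "f - g" g]
    by (simp add: left_diff_distrib of_domain_add distrib_right)
  with vw show ?case by (blast intro: inverse_diff_ops_diff)
next
  case (mult x y)
  from mult.IH(2) obtain f v where v: "v \<in> inverse_diff_ops"
    "y * of_domain (op_const a) * of_domain op_del = of_domain (op_const f) * of_domain op_del + v"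
    by blast
  from mult.IH(1) obtain g w where w: "w \<in> inverse_diff_ops"
    "x * of_domain (op_const f) * of_domain op_del = of_domain (op_const g) * of_domain op_del + w"
    by blast
  have "x * y * of_domain (op_const a) * of_domain op_del =
      x * (y * of_domain (op_const a) * of_domain op_del)"
    by (simp add: mult.assoc)
  also have "\<dots> = of_domain (op_const g) * of_domain op_del + (w + x * v)"
    using v(2) w(2) by (simp add: distrib_left mult.assoc add.assoc)
  finally show ?case
    using v(1) w(1) mult.hyps(1)[folded inverse_diff_ops_def]
    by (blast intro: inverse_diff_ops_add inverse_diff_ops_mult)
qed

lemma diff_ops_plus_inverse_diff_ops_add:
  assumes "x \<in> diff_ops + inverse_diff_ops" "y \<in> diff_ops + inverse_diff_ops"
  shows "x + y \<in> diff_ops + inverse_diff_ops"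
proof -
  obtain P v Q w where vw: "v \<in> inverse_diff_ops" "w \<in> inverse_diff_ops"
    and "x = of_domain P + v" "y = of_domain Q + w"
    using assms by (auto simp: diff_ops_def set_plus_def)
  then have "x + y = of_domain (P + Q) + (v + w)"
    by (simp add: of_domain_add algebra_simps)
  with vw show ?thesis
    by (auto simp: diff_ops_def intro: set_plus_intro inverse_diff_ops_add)
qed

lemma diff_op_in_sum: "of_domain P \<in> diff_ops + inverse_diff_ops"
  using set_plus_intro[of "of_domain P" diff_ops 0 inverse_diff_ops]
  by (simp add: diff_ops_def inverse_diff_ops_0)

lemma inverse_diff_op_mult_del_pow:
  "x \<in> inverse_diff_ops \<Longrightarrow> x * of_domain (op_del ^ i) \<in> diff_ops + inverse_diff_ops"
proof (induction i arbitrary: x)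
  case 0
  then show ?case
    using set_plus_intro[of "of_domain 0" diff_ops x inverse_diff_ops, unfolded diff_ops_def, OF rangeI]
    by (simp add: diff_ops_def of_domain_0 of_domain_1)
next
  case (Suc i)
  obtain f w where w: "w \<in> inverse_diff_ops"
    and x: "x * of_domain op_del = of_domain (op_const f) * of_domain op_del + w"
    using inverse_diff_op_mult_del[OF Suc.prems, of 1] by (auto simp: op_const_1 of_domain_1)
  have "x * of_domain (op_del ^ Suc i) = x * of_domain op_del * of_domain (op_del ^ i)"
    by (simp add: of_domain_mult mult.assoc)
  also have "\<dots> = of_domain (op_const f * op_del ^ Suc i) + w * of_domain (op_del ^ i)"
    by (simp add: x of_domain_mult distrib_right mult.assoc)
  finally show ?case
    using diff_ops_plus_inverse_diff_ops_add[OF diff_op_in_sum Suc.IH[OF w]] by simp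
qed

lemma inverse_diff_op_mult_diff_op:
  assumes "x \<in> inverse_diff_ops"
  shows "x * of_domain Q \<in> diff_ops + inverse_diff_ops"
proof -
  have "x * of_domain Q =
      x * of_domain (\<Sum>i\<le>op_degree Q. op_const (op_coeff Q i) * op_del ^ i)"
    by (simp flip: diff_op_normal_form)
  also have "\<dots> = (\<Sum>i\<le>op_degree Q.
      x * of_domain (op_const (op_coeff Q i)) * of_domain (op_del ^ i))"
    by (simp add: of_domain_sum of_domain_mult sum_distrib_left mult.assoc)
  also have "\<dots> \<in> diff_ops + inverse_diff_ops"
  proof -
    have "x * of_domain (op_const (op_coeff Q i)) * of_domain (op_del ^ i)
        \<in> diff_ops + inverse_diff_ops" for i
      using assms
      by (intro inverse_diff_op_mult_del_pow inverse_diff_ops_mult const_in_inverse_diff_ops)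
    then have "(\<Sum>i\<le>n. x * of_domain (op_const (op_coeff Q i)) * of_domain (op_del ^ i))
        \<in> diff_ops + inverse_diff_ops" for n
      by (induction n)
        (simp_all only: atMost_0 sum.atMost_Suc sum.insert sum.empty finite.emptyI empty_iff
          not_False_eq_True add_0_right diff_ops_plus_inverse_diff_ops_add)
    then show ?thesis .
  qed
  finally show ?thesis .
qed

theorem theorem3p8:
  assumes "linearly_differentially_closed TYPE('a :: {differential_field, field_char_0})"
    and "algebraically_closed_subfield (constants :: 'a set)"
    and "(constants :: 'a set) \<noteq> UNIV"
  shows "(UNIV :: 'a rat_pseudo_diff_op set) = diff_ops + inverse_diff_ops"
proof -
  have "x \<in> diff_ops + inverse_diff_ops" for x :: "'a rat_pseudo_diff_op"
  proof -
    obtain P Q where "P \<noteq> 0" "x = inverse (of_domain P) * of_domain Q"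
      using ore_quot_fraction by blast
    with inverse_diff_op_in_inverse_diff_ops[OF assms(1)] show ?thesis
      by (simp add: inverse_diff_op_mult_diff_op)
  qed
  then show ?thesis by blast
qed

end
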